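(* Let $\mathcal G=(G\rightrightarrows M)$ be a Lie groupoid with source $\alpha$ and target $\beta$. If $A$ is a subgroup of $(S_{\mathcal G}(\alpha),\star)$, then $\Gamma(A)=\bigcup_{f\in A}\Gamma_f$ forms a wide subgroupoid of the groupoid $G^{(2)}$, where $\Gamma_f=\{(x,f(x))\mid x\in G\}$ is the graph of $f$.
   Context: In a Lie groupoid $G\rightrightarrows M$ ($G,M$ finite-dimensional paracompact Hausdorff) the source $\alpha$ and target $\beta$ are submersions $G\to M$; the product $xy$ is defined iff $\alpha(x)=\beta(y)$, and then $\beta(xy)=\beta(x)$, $\alpha(xy)=\alpha(y)$; $M$ is identified with the submanifold of units of $G$. $S_{\mathcal G}=\{f\in C^\infty(G,G)\mid\beta\circ f=\alpha\}$ is a monoid under $(f\star g)(x)=f(x)\,g\big(xf(x)\big)$ with unit $\alpha$; its group of units is $S_{\mathcal G}(\alpha)=\{f\in S_{\mathcal G}\mid R_f\in\mathrm{Diff}(G)\}$, where $R_f(x)=xf(x)$. $G^{(2)}=\{(x,y)\in G\times G\mid\alpha(x)=\beta(y)\}$ is a groupoid with object space $(G^{(2)})^0=\{(x,\alpha(x))\mid x\in G\}$, target $\beta^2(x,y)=(x,\alpha(x))$, source $\alpha^2(x,y)=(xy,\alpha(xy))$, multiplication $(x,y)(xy,w)=(x,yw)$ (a pair $((x,y),(z,w))$ is composable iff $z=xy$), and inverse $(x,y)^{-1}=(xy,y^{-1})$. A subgroupoid is wide if it contains all units. For $f\in S_{\mathcal G}$ one has $\Gamma_f\subseteq G^{(2)}$.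 *)

theory Defs
  imports "HOL-Analysis.Analysis" "HOL-Algebra.Group"
begin

section \<open>Smooth functions on open subsets of Euclidean space\<close>

text \<open>
  The model spaces are the library's \<^term>\<open>Euclidean_space n\<close>: real sequences that vanish
  from index \<^term>\<open>n\<close> on. The dimension is thus an ordinary natural number, and
  \<^prop>\<open>n = 0\<close> is allowed; the latter is needed for Lie groups, whose base is a point.
\<close>

definition partial_deriv :: "nat \<Rightarrow> ((nat \<Rightarrow> real) \<Rightarrow> real) \<Rightarrow> (nat \<Rightarrow> real) \<Rightarrow> real" where
  "partial_deriv i f x = deriv (\<lambda>t. f (x(i := t))) (x i)"

text \<open>\<open>Ck_on n k S f\<close> is only meant for \<open>S\<close> open in \<^term>\<open>Euclidean_space n\<close>: then
  \<open>x(i := t)\<close> lies in \<open>S\<close> for \<open>t\<close> near \<open>x i\<close>, so values of \<open>f\<close> outside \<open>S\<close> are irrelevant.\<close>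

primrec Ck_on :: "nat \<Rightarrow> nat \<Rightarrow> (nat \<Rightarrow> real) set \<Rightarrow> ((nat \<Rightarrow> real) \<Rightarrow> real) \<Rightarrow> bool" where
  "Ck_on n 0 S f \<longleftrightarrow> continuous_map (subtopology (Euclidean_space n) S) euclideanreal f"
| "Ck_on n (Suc k) S f \<longleftrightarrow>
     continuous_map (subtopology (Euclidean_space n) S) euclideanreal f \<and>
     (\<forall>i<n. (\<forall>x\<in>S. (\<lambda>t. f (x(i := t))) differentiable (at (x i))) \<and>
            Ck_on n k S (partial_deriv i f))"

definition smooth_on ::
  "nat \<Rightarrow> nat \<Rightarrow> (nat \<Rightarrow> real) set \<Rightarrow> ((nat \<Rightarrow> real) \<Rightarrow> (nat \<Rightarrow> real)) \<Rightarrow> bool" where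
  "smooth_on n m S f \<longleftrightarrow> f ` S \<subseteq> topspace (Euclidean_space m) \<and>
     (\<forall>j<m. \<forall>k. Ck_on n k S (\<lambda>x. f x j))"


section \<open>Smooth manifolds\<close>

text \<open>A chart is a pair of its domain and the coordinate map, whose values outside the domain
  are irrelevant. The atlas need not be maximal.\<close>

type_synonym 'a chart = "'a set \<times> ('a \<Rightarrow> nat \<Rightarrow> real)"

record 'a manifold =
  mtop :: "'a topology"
  mdim :: nat
  atlas :: "'a chart set"

abbreviation points :: "'a manifold \<Rightarrow> 'a set" where
  "points X \<equiv> topspace (mtop X)"

definition is_chart :: "'a topology \<Rightarrow> nat \<Rightarrow> 'a chart \<Rightarrow> bool" where
  "is_chart T n = (\<lambda>(U, \<phi>). openin T U \<and> openin (Euclidean_space n) (\<phi> ` U) \<and>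
     homeomorphic_map (subtopology T U) (subtopology (Euclidean_space n) (\<phi> ` U)) \<phi>)"

definition compatible :: "nat \<Rightarrow> 'a chart \<Rightarrow> 'a chart \<Rightarrow> bool" where
  "compatible n = (\<lambda>(U, \<phi>) (V, \<psi>).
     smooth_on n n (\<phi> ` (U \<inter> V)) (\<psi> \<circ> inv_into U \<phi>) \<and>
     smooth_on n n (\<psi> ` (U \<inter> V)) (\<phi> \<circ> inv_into V \<psi>))"

definition paracompact_space :: "'a topology \<Rightarrow> bool" where
  "paracompact_space T \<longleftrightarrow>
     (\<forall>\<U>. (\<forall>U\<in>\<U>. openin T U) \<and> \<Union>\<U> = topspace T \<longrightarrow>
        (\<exists>\<V>. (\<forall>V\<in>\<V>. openin T V) \<and> \<Union>\<V> = topspace T \<and>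
             (\<forall>V\<in>\<V>. \<exists>U\<in>\<U>. V \<subseteq> U) \<and> locally_finite_in T \<V>))"

definition smooth_manifold :: "'a manifold \<Rightarrow> bool" where
  "smooth_manifold X \<longleftrightarrow>
     Hausdorff_space (mtop X) \<and> paracompact_space (mtop X) \<and>
     (\<forall>c\<in>atlas X. is_chart (mtop X) (mdim X) c) \<and>
     \<Union>(fst ` atlas X) = points X \<and>
     (\<forall>c\<in>atlas X. \<forall>d\<in>atlas X. compatible (mdim X) c d)"

definition max_atlas :: "'a manifold \<Rightarrow> 'a chart set" where
  "max_atlas X = {c. is_chart (mtop X) (mdim X) c \<and> (\<forall>d\<in>atlas X. compatible (mdim X) c d)}"

definition smooth_map :: "'a manifold \<Rightarrow> 'b manifold \<Rightarrow> ('a \<Rightarrow> 'b) \<Rightarrow> bool" where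
  "smooth_map X Y f \<longleftrightarrow> continuous_map (mtop X) (mtop Y) f \<and>
     (\<forall>(U, \<phi>)\<in>atlas X. \<forall>(V, \<psi>)\<in>atlas Y.
        smooth_on (mdim X) (mdim Y) (\<phi> ` (U \<inter> f -` V)) (\<psi> \<circ> f \<circ> inv_into U \<phi>))"

definition diffeomorphism :: "'a manifold \<Rightarrow> 'b manifold \<Rightarrow> ('a \<Rightarrow> 'b) \<Rightarrow> bool" where
  "diffeomorphism X Y f \<longleftrightarrow> bij_betw f (points X) (points Y) \<and>
     smooth_map X Y f \<and> smooth_map Y X (inv_into (points X) f)"

text \<open>A submersion is a smooth map whose Jacobian, in local coordinates, is onto at every
  point.\<close>

definition submersion :: "'a manifold \<Rightarrow> 'b manifold \<Rightarrow> ('a \<Rightarrow> 'b) \<Rightarrow> bool" where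
  "submersion X Y f \<longleftrightarrow> smooth_map X Y f \<and>
     (\<forall>(U, \<phi>)\<in>atlas X. \<forall>(V, \<psi>)\<in>atlas Y. \<forall>p \<in> U \<inter> f -` V. \<forall>w :: nat \<Rightarrow> real. \<exists>v :: nat \<Rightarrow> real.
        \<forall>j<mdim Y. (\<Sum>i<mdim X.
          partial_deriv i (\<lambda>x. \<psi> (f (inv_into U \<phi> x)) j) (\<phi> p) * v i) = w j)"

definition prod_manifold :: "'a manifold \<Rightarrow> 'b manifold \<Rightarrow> ('a \<times> 'b) manifold" where
  "prod_manifold X Y =
     \<lparr>mtop = prod_topology (mtop X) (mtop Y),
      mdim = mdim X + mdim Y,
      atlas = {(U \<times> V, \<lambda>(p, q) i. if i < mdim X then \<phi> p i else \<psi> q (i - mdim X)) |U \<phi> V \<psi>.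
                 (U, \<phi>) \<in> atlas X \<and> (V, \<psi>) \<in> atlas Y}\<rparr>"

text \<open>Slice charts flatten \<open>S\<close> to \<^term>\<open>Euclidean_space k\<close>, which for \<open>k \<le> n\<close> is literally
  the subset of \<^term>\<open>Euclidean_space n\<close> where the last \<open>n - k\<close> coordinates vanish.\<close>

definition slice_charts :: "'a manifold \<Rightarrow> 'a set \<Rightarrow> nat \<Rightarrow> 'a chart set" where
  "slice_charts X S k =
     {(U, \<phi>) \<in> max_atlas X. \<phi> ` (U \<inter> S) = \<phi> ` U \<inter> topspace (Euclidean_space k)}"

definition embedded_submanifold :: "'a manifold \<Rightarrow> 'a set \<Rightarrow> nat \<Rightarrow> bool" where
  "embedded_submanifold X S k \<longleftrightarrow>
     S \<subseteq> points X \<and> k \<le> mdim X \<and> (\<forall>p\<in>S. \<exists>(U, \<phi>)\<in>slice_charts X S k. p \<in> U)"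

definition submanifold :: "'a manifold \<Rightarrow> 'a set \<Rightarrow> nat \<Rightarrow> 'a manifold" where
  "submanifold X S k =
     \<lparr>mtop = subtopology (mtop X) S,
      mdim = k,
      atlas = {(U \<inter> S, \<phi>) |U \<phi>. (U, \<phi>) \<in> slice_charts X S k}\<rparr>"


section \<open>Groupoids\<close>

text \<open>Objects are identified with units. The product \<open>cmp \<G> x y\<close> is meaningful iff
  \<open>src \<G> x = tgt \<G> y\<close>.\<close>

record 'g groupoid =
  arr :: "'g set"
  units :: "'g set"
  src :: "'g \<Rightarrow> 'g"
  tgt :: "'g \<Rightarrow> 'g"
  cmp :: "'g \<Rightarrow> 'g \<Rightarrow> 'g"
  ginv :: "'g \<Rightarrow> 'g"

locale groupoid =
  fixes \<G> :: "'g groupoid"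
  assumes units_subset: "units \<G> \<subseteq> arr \<G>"
    and src_in: "x \<in> arr \<G> \<Longrightarrow> src \<G> x \<in> units \<G>"
    and tgt_in: "x \<in> arr \<G> \<Longrightarrow> tgt \<G> x \<in> units \<G>"
    and src_unit: "u \<in> units \<G> \<Longrightarrow> src \<G> u = u"
    and tgt_unit: "u \<in> units \<G> \<Longrightarrow> tgt \<G> u = u"
    and cmp_in: "\<lbrakk>x \<in> arr \<G>; y \<in> arr \<G>; src \<G> x = tgt \<G> y\<rbrakk> \<Longrightarrow> cmp \<G> x y \<in> arr \<G>"
    and src_cmp: "\<lbrakk>x \<in> arr \<G>; y \<in> arr \<G>; src \<G> x = tgt \<G> y\<rbrakk> \<Longrightarrow> src \<G> (cmp \<G> x y) = src \<G> y"
    and tgt_cmp: "\<lbrakk>x \<in> arr \<G>; y \<in> arr \<G>; src \<G> x = tgt \<G> y\<rbrakk> \<Longrightarrow> tgt \<G> (cmp \<G> x y) = tgt \<G> x"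
    and cmp_assoc: "\<lbrakk>x \<in> arr \<G>; y \<in> arr \<G>; z \<in> arr \<G>; src \<G> x = tgt \<G> y; src \<G> y = tgt \<G> z\<rbrakk>
      \<Longrightarrow> cmp \<G> (cmp \<G> x y) z = cmp \<G> x (cmp \<G> y z)"
    and cmp_src: "x \<in> arr \<G> \<Longrightarrow> cmp \<G> x (src \<G> x) = x"
    and tgt_cmp_left: "x \<in> arr \<G> \<Longrightarrow> cmp \<G> (tgt \<G> x) x = x"
    and ginv_in: "x \<in> arr \<G> \<Longrightarrow> ginv \<G> x \<in> arr \<G>"
    and src_ginv: "x \<in> arr \<G> \<Longrightarrow> src \<G> (ginv \<G> x) = tgt \<G> x"
    and tgt_ginv: "x \<in> arr \<G> \<Longrightarrow> tgt \<G> (ginv \<G> x) = src \<G> x"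
    and cmp_ginv: "x \<in> arr \<G> \<Longrightarrow> cmp \<G> x (ginv \<G> x) = tgt \<G> x"
    and ginv_cmp: "x \<in> arr \<G> \<Longrightarrow> cmp \<G> (ginv \<G> x) x = src \<G> x"

locale subgroupoid = groupoid \<G> for H :: "'g set" and \<G> :: "'g groupoid" +
  assumes sub_arr: "H \<subseteq> arr \<G>"
    and sub_src: "x \<in> H \<Longrightarrow> src \<G> x \<in> H"
    and sub_tgt: "x \<in> H \<Longrightarrow> tgt \<G> x \<in> H"
    and sub_cmp: "\<lbrakk>x \<in> H; y \<in> H; src \<G> x = tgt \<G> y\<rbrakk> \<Longrightarrow> cmp \<G> x y \<in> H"
    and sub_ginv: "x \<in> H \<Longrightarrow> ginv \<G> x \<in> H"

locale wide_subgroupoid = subgroupoid +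
  assumes wide: "units \<G> \<subseteq> H"

definition composable_pairs :: "'g groupoid \<Rightarrow> ('g \<times> 'g) set" where
  "composable_pairs \<G> = {(x, y). x \<in> arr \<G> \<and> y \<in> arr \<G> \<and> src \<G> x = tgt \<G> y}"

definition pair_groupoid :: "'g groupoid \<Rightarrow> ('g \<times> 'g) groupoid" where
  "pair_groupoid \<G> =
     \<lparr>arr = composable_pairs \<G>,
      units = {(x, src \<G> x) |x. x \<in> arr \<G>},
      src = (\<lambda>(x, y). (cmp \<G> x y, src \<G> (cmp \<G> x y))),
      tgt = (\<lambda>(x, y). (x, src \<G> x)),
      cmp = (\<lambda>(x, y) (z, w). (x, cmp \<G> y w)),
      ginv = (\<lambda>(x, y). (cmp \<G> x y, ginv \<G> y))\<rparr>"


section \<open>Lie groupoids\<close>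

text \<open>\<open>X\<close> is the manifold structure on the set of arrows and \<open>k\<close> the dimension of the base,
  which is the embedded submanifold of units. The space of composable pairs is an embedded
  submanifold of dimension \<open>2 dim X - k\<close>, since source and target are submersions onto
  a \<open>k\<close>-dimensional manifold.\<close>

locale lie_groupoid = groupoid \<G>
  for \<G> :: "'g groupoid" and X :: "'g manifold" and k :: nat +
  assumes arrows: "arr \<G> = points X"
    and manifold_arrows: "smooth_manifold X"
    and embedded_units: "embedded_submanifold X (units \<G>) k"
    and manifold_units: "smooth_manifold (submanifold X (units \<G>) k)"
    and submersion_src: "submersion X (submanifold X (units \<G>) k) (src \<G>)"
    and submersion_tgt: "submersion X (submanifold X (units \<G>) k) (tgt \<G>)"
    and smooth_cmp: "smooth_map
      (submanifold (prod_manifold X X) (composable_pairs \<G>) (2 * mdim X - k)) X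
      (\<lambda>(x, y). cmp \<G> x y)"
    and smooth_ginv: "smooth_map X X (ginv \<G>)"

text \<open>Maps on the set of arrows are represented by extensional functions, so that maps that agree
  on all arrows are equal.\<close>

definition S_monoid :: "'g groupoid \<Rightarrow> 'g manifold \<Rightarrow> ('g \<Rightarrow> 'g) monoid" where
  "S_monoid \<G> X =
     \<lparr>carrier = {f \<in> extensional (arr \<G>). smooth_map X X f \<and> (\<forall>x\<in>arr \<G>. tgt \<G> (f x) = src \<G> x)},
      mult = (\<lambda>f g. \<lambda>x\<in>arr \<G>. cmp \<G> (f x) (g (cmp \<G> x (f x)))),
      one = restrict (src \<G>) (arr \<G>)\<rparr>"

definition S_group :: "'g groupoid \<Rightarrow> 'g manifold \<Rightarrow> ('g \<Rightarrow> 'g) monoid" where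
  "S_group \<G> X = (S_monoid \<G> X)
     \<lparr>carrier := {f \<in> carrier (S_monoid \<G> X). diffeomorphism X X (\<lambda>x. cmp \<G> x (f x))}\<rparr>"

definition graph :: "'g groupoid \<Rightarrow> ('g \<Rightarrow> 'g) \<Rightarrow> ('g \<times> 'g) set" where
  "graph \<G> f = {(x, f x) |x. x \<in> arr \<G>}"

end

theory Submission
  imports Defs
begin

text \<open>
  Units, products and inverses of the graphs correspond to those of \<open>A\<close>: for
  \<open>z = x f(x)\<close> one has \<open>(x, f(x)) (z, g(z)) = (x, (f \<star> g)(x))\<close>, and
  \<open>(x, f(x))\<inverse> = (z, f(x)\<inverse>)\<close> lies on the graph of \<open>g = f\<inverse>\<close>. The latter is
  \<open>g = inversion \<circ> f \<circ> R_f\<inverse>\<close>, which has to be known to exist in the group: the inverse in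
  \<open>A\<close> is a definite description, meaningless without an actual smooth inverse. Hence
  smoothness of composites, and thus the chain rule for \<^const>\<open>Ck_on\<close>, is the analytic core.
\<close>


section \<open>The chain rule in Euclidean space\<close>

text \<open>A basic open set of the product topology gives a radius for every coordinate. From index
  \<open>n\<close> on, \<open>p\<close> and \<open>q\<close> both vanish, so only finitely many
  radii count and their minimum serves.\<close>

lemma openin_Euclidean_space_box:
  assumes "openin (Euclidean_space n) S" "p \<in> S"
  obtains d where "d > 0"
    "\<And>q. \<lbrakk>q \<in> topspace (Euclidean_space n); \<And>i. i < n \<Longrightarrow> \<bar>q i - p i\<bar> < d\<rbrakk> \<Longrightarrow> q \<in> S"
proof -
  obtain T where T: "openin (powertop_real UNIV) T" "S = T \<inter> {x. \<forall>i\<ge>n. x i = 0}"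
    using assms(1) unfolding Euclidean_space_def openin_subtopology by blast
  with assms(2) have p: "p \<in> T" "\<And>i. i \<ge> n \<Longrightarrow> p i = 0" by auto
  obtain B where B: "p \<in> (\<Pi>\<^sub>E i\<in>UNIV. B i)" "\<And>i. open (B i)" "(\<Pi>\<^sub>E i\<in>UNIV. B i) \<subseteq> T"
    using product_topology_open_contains_basis[OF T(1) p(1)]
    by (auto simp flip: open_openin)
  have "\<exists>e>0. ball (p i) e \<subseteq> B i" for i
    using B(1) B(2)[of i] open_contains_ball by blast
  then obtain e where e: "\<And>i. e i > 0" "\<And>i. ball (p i) (e i) \<subseteq> B i" by metis
  \<comment> \<open>The inserted 1 keeps the set nonempty when \<open>n = 0\<close>.\<close>
  define d where "d = Min (insert 1 (e ` {..<n}))"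
  have d: "d \<le> e i" if "i < n" for i
    unfolding d_def using that by (intro Min_le) auto
  show thesis
  proof
    show "d > 0" unfolding d_def using e(1) by (subst Min_gr_iff) auto
  next
    fix q assume q: "q \<in> topspace (Euclidean_space n)" "\<And>i. i < n \<Longrightarrow> \<bar>q i - p i\<bar> < d"
    have "q i \<in> B i" for i
    proof (cases "i < n")
      case True
      then have "q i \<in> ball (p i) (e i)"
        using q(2)[OF True] d[OF True] by (auto simp: dist_real_def)
      then show ?thesis using e(2) by blast
    next
      case False
      then have "q i = p i" using q(1) p(2) by (auto simp: topspace_Euclidean_space)
      then show ?thesis using B(1) by auto
    qed
    then have "q \<in> T" using B(3) by auto
    then show "q \<in> S" using q(1) T(2) by (auto simp: topspace_Euclidean_space)
  qed
qed

lemma continuous_map_Euclidean_space_iff_components: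
  "continuous_map X (Euclidean_space m) f \<longleftrightarrow>
     f ` topspace X \<subseteq> topspace (Euclidean_space m) \<and>
     (\<forall>j<m. continuous_map X euclideanreal (\<lambda>x. f x j))" (is "?L \<longleftrightarrow> ?R")
proof
  assume ?L
  then show ?R
    by (auto simp: Euclidean_space_def continuous_map_in_subtopology
        continuous_map_componentwise_UNIV)
next
  assume R: ?R
  \<comment> \<open>The componentwise criterion is about truncated maps; on
    \<open>topspace X\<close> truncation does not change \<open>f\<close>.\<close>
  then have "continuous_map X (Euclidean_space m) (\<lambda>x i. if i < m then f x i else 0)"
    by (simp add: continuous_map_componentwise_Euclidean_space)
  then show ?L
    by (rule continuous_map_eq) (use R in \<open>force simp: topspace_Euclidean_space\<close>)
qed

lemma topspace_subtopology_open:
  "openin T S \<Longrightarrow> topspace (subtopology T S) = S"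
  by (rule topspace_subtopology_subset) (rule openin_subset)

text \<open>A partial derivative at \<open>x\<close> sees only the coordinate line through
  \<open>x\<close>. A short piece of that line lies in the open set \<open>S\<close>, so the values
  on \<open>S\<close> determine the derivative.\<close>

lemma eventually_update_in_open:
  assumes "openin (Euclidean_space n) S" "x \<in> S" "i < n"
  shows "\<forall>\<^sub>F t in nhds (x i). x(i := t) \<in> S"
proof -
  obtain d where d: "d > 0"
    "\<And>q. \<lbrakk>q \<in> topspace (Euclidean_space n); \<And>i. i < n \<Longrightarrow> \<bar>q i - x i\<bar> < d\<rbrakk> \<Longrightarrow> q \<in> S"
    using openin_Euclidean_space_box[OF assms(1,2)] by blast
  have x: "x \<in> topspace (Euclidean_space n)"
    using assms openin_subset by blast
  have "x(i := t) \<in> S" if "dist t (x i) < d" for t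
    using that d(1) x assms(3) by (intro d(2)) (auto simp: topspace_Euclidean_space dist_real_def)
  then show ?thesis
    unfolding eventually_nhds_metric using d(1) by blast
qed

lemma partial_deriv_cong:
  assumes "openin (Euclidean_space n) S" "x \<in> S" "i < n" "\<And>y. y \<in> S \<Longrightarrow> f y = g y"
  shows "partial_deriv i f x = partial_deriv i g x"
  unfolding partial_deriv_def
  using eventually_mono[OF eventually_update_in_open[OF assms(1-3)]] assms(4)
  by (intro deriv_cong_ev) auto

lemma differentiable_update_cong:
  fixes f g :: "(nat \<Rightarrow> real) \<Rightarrow> real"
  assumes "openin (Euclidean_space n) S" "x \<in> S" "i < n" "\<And>y. y \<in> S \<Longrightarrow> f y = g y"
    and "(\<lambda>t. f (x(i := t))) differentiable (at (x i))"
  shows "(\<lambda>t. g (x(i := t))) differentiable (at (x i))"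
proof -
  have "\<forall>\<^sub>F t in nhds (x i). f (x(i := t)) = g (x(i := t))"
    using eventually_mono[OF eventually_update_in_open[OF assms(1-3)]] assms(4) by auto
  then show ?thesis
    using assms(5) unfolding real_differentiable_def by (metis DERIV_cong_ev)
qed

section \<open>Locality of \<open>Ck_on\<close>, and its closure under sums and products\<close>

lemma Ck_on_imp_continuous_map:
  "Ck_on n k S f \<Longrightarrow> continuous_map (subtopology (Euclidean_space n) S) euclideanreal f"
  by (cases k) auto

lemma Ck_on_SucD: "Ck_on n (Suc k) S f \<Longrightarrow> Ck_on n k S f"
proof (induction k arbitrary: f)
  case (Suc k)
  have "Ck_on n k S (partial_deriv i f)" if "i < n" for i
    using Suc.prems that by (intro Suc.IH) simp
  then show ?case using Suc.prems by simp
qed simp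

lemma Ck_on_has_partial_deriv:
  assumes "Ck_on n (Suc k) S f" "x \<in> S" "i < n"
  shows "((\<lambda>t. f (x(i := t))) has_real_derivative partial_deriv i f x) (at (x i))"
  using assms unfolding partial_deriv_def
  by (auto simp: DERIV_deriv_iff_real_differentiable)

text \<open>This allows \<open>partial_deriv i\<close> of a compound function to be replaced by the
  explicit formula of a differentiation rule, which holds on \<open>S\<close> only.\<close>

lemma Ck_on_cong:
  assumes "openin (Euclidean_space n) S" "\<And>y. y \<in> S \<Longrightarrow> f y = g y" "Ck_on n k S f"
  shows "Ck_on n k S g"
  using assms(2,3)
proof (induction k arbitrary: f g)
  case 0
  then show ?case by (auto elim: continuous_map_eq)
next
  case (Suc k)
  have "Ck_on n k S (partial_deriv i g)" if "i < n" for i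
    using Suc.prems that partial_deriv_cong[OF assms(1) _ that, of _ f g]
    by (intro Suc.IH[of "partial_deriv i f" "partial_deriv i g"]) auto
  then show ?case
    using Suc differentiable_update_cong[OF assms(1), of _ _ f g]
    by (auto elim: continuous_map_eq)
qed

lemma Ck_on_subset: "Ck_on n k T f \<Longrightarrow> S \<subseteq> T \<Longrightarrow> Ck_on n k S f"
  by (induction k arbitrary: f) (auto intro: continuous_map_from_subtopology_mono)

lemma continuous_map_subtopology_local:
  assumes "\<And>x. x \<in> S \<Longrightarrow>
    \<exists>T. openin X T \<and> x \<in> T \<and> T \<subseteq> S \<and> continuous_map (subtopology X T) Y f"
  shows "continuous_map (subtopology X S) Y f"
\<comment> \<open>The cover is indexed by its own members, and the pasted pieces are all
  restrictions of \<open>f\<close>.\<close>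
proof (rule pasting_lemma[where T = id and f = "\<lambda>_. f"
      and I = "{T. openin X T \<and> T \<subseteq> S \<and> continuous_map (subtopology X T) Y f}"])
  show "openin (subtopology X S) (id T)"
    if "T \<in> {T. openin X T \<and> T \<subseteq> S \<and> continuous_map (subtopology X T) Y f}" for T
    using that by (auto simp: openin_subtopology)
qed (use assms in \<open>auto simp: subtopology_subtopology inf_absorb2\<close>)

text \<open>Differentiability is a pointwise condition and continuity is glued from an open cover.
  Composites on manifolds need this, since they factor through a chart of the middle manifold only
  near each point.\<close>

lemma Ck_on_local:
  assumes "\<And>x. x \<in> S \<Longrightarrow> \<exists>T. openin (Euclidean_space n) T \<and> x \<in> T \<and> T \<subseteq> S \<and> Ck_on n k T f"
  shows "Ck_on n k S f"
  using assms
proof (induction k arbitrary: f)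
  case 0
  then show ?case by (simp add: continuous_map_subtopology_local)
next
  case (Suc k f)
  have "continuous_map (subtopology (Euclidean_space n) S) euclideanreal f"
    using Suc.prems by (intro continuous_map_subtopology_local) fastforce
  moreover have "Ck_on n k S (partial_deriv i f)" if "i < n" for i
    using Suc.prems that by (intro Suc.IH) fastforce
  moreover have "(\<lambda>t. f (x(i := t))) differentiable (at (x i))" if "i < n" "x \<in> S" for i x
    using Suc.prems[OF that(2)] that(1) by auto
  ultimately show ?case by simp
qed

lemma Ck_on_add:
  assumes S: "openin (Euclidean_space n) S" and "Ck_on n k S f" "Ck_on n k S g"
  shows "Ck_on n k S (\<lambda>x. f x + g x)"
  using assms(2,3)
proof (induction k arbitrary: f g)
  case 0
  then show ?case by (auto intro: continuous_map_add)
next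
  case (Suc k)
  have d: "((\<lambda>t. f (x(i := t)) + g (x(i := t))) has_real_derivative
      partial_deriv i f x + partial_deriv i g x) (at (x i))" if "x \<in> S" "i < n" for x i
    using Suc.prems that by (intro derivative_intros Ck_on_has_partial_deriv)
  have "Ck_on n k S (partial_deriv i (\<lambda>x. f x + g x))" if "i < n" for i
  proof (rule Ck_on_cong[OF S])
    show "Ck_on n k S (\<lambda>x. partial_deriv i f x + partial_deriv i g x)"
      using Suc that by auto
    show "partial_deriv i f x + partial_deriv i g x = partial_deriv i (\<lambda>x. f x + g x) x"
      if "x \<in> S" for x
      using DERIV_imp_deriv[OF d[OF that \<open>i < n\<close>]] by (simp add: partial_deriv_def)
  qed
  moreover have "(\<lambda>t. f (x(i := t)) + g (x(i := t))) differentiable (at (x i))"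
    if "x \<in> S" "i < n" for x i
    using d[OF that] real_differentiable_def by blast
  ultimately show ?case
    using Suc.prems by (auto intro: continuous_map_add)
qed

lemma Ck_on_mult:
  assumes S: "openin (Euclidean_space n) S" and "Ck_on n k S f" "Ck_on n k S g"
  shows "Ck_on n k S (\<lambda>x. f x * g x)"
  using assms(2,3)
proof (induction k arbitrary: f g)
  case 0
  then show ?case by (auto intro: continuous_map_real_mult)
next
  case (Suc k)
  have d: "((\<lambda>t. f (x(i := t)) * g (x(i := t))) has_real_derivative
      partial_deriv i f x * g x + partial_deriv i g x * f x) (at (x i))" if "x \<in> S" "i < n" for x i
    using DERIV_mult[OF Ck_on_has_partial_deriv[OF Suc.prems(1) that]
        Ck_on_has_partial_deriv[OF Suc.prems(2) that]] by (simp only: fun_upd_triv)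
  have "Ck_on n k S (partial_deriv i (\<lambda>x. f x * g x))" if "i < n" for i
  proof (rule Ck_on_cong[OF S])
    show "Ck_on n k S (\<lambda>x. partial_deriv i f x * g x + partial_deriv i g x * f x)"
      \<comment> \<open>The Leibniz formula also contains \<open>f\<close> and \<open>g\<close>
        themselves, so these are lowered from order \<open>Suc k\<close> to order
        \<open>k\<close>.\<close>
      using Suc.prems[THEN Ck_on_SucD] Suc.prems that
      by (intro Ck_on_add[OF S] Suc.IH) auto
    show "partial_deriv i f x * g x + partial_deriv i g x * f x = partial_deriv i (\<lambda>x. f x * g x) x"
      if "x \<in> S" for x
      using DERIV_imp_deriv[OF d[OF that \<open>i < n\<close>]] by (simp add: partial_deriv_def)
  qed
  moreover have "(\<lambda>t. f (x(i := t)) * g (x(i := t))) differentiable (at (x i))"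
    if "x \<in> S" "i < n" for x i
    using d[OF that] real_differentiable_def by blast
  ultimately show ?case
    using Suc.prems by (auto intro: continuous_map_real_mult)
qed

lemma Ck_on_const: "Ck_on n k S (\<lambda>x. c)"
proof (induction k arbitrary: c)
  case (Suc k)
  have "partial_deriv i (\<lambda>x. c) = (\<lambda>x. 0)" for i
    by (rule ext) (simp add: partial_deriv_def)
  with Suc show ?case by simp
qed simp

lemma Ck_on_sum:
  assumes S: "openin (Euclidean_space n) S" and "finite J" "\<And>j. j \<in> J \<Longrightarrow> Ck_on n k S (f j)"
  shows "Ck_on n k S (\<lambda>x. \<Sum>j\<in>J. f j x)"
  using assms(2,3) by (induction J) (auto intro: Ck_on_const Ck_on_add[OF S])

section \<open>Total differentiability of C^1 functions and the chain rule\<close>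

text \<open>Since the partial derivatives are continuous, they stay within \<open>e\<close> of their
  values at \<open>p\<close> on a whole box around \<open>p\<close>. This bounds the error against
  the l^1 distance.\<close>

lemma C1_linearization:
  assumes S: "openin (Euclidean_space n) S" and f: "Ck_on n (Suc 0) S f"
    and p: "p \<in> S" and e: "e > 0"
  obtains d where "d > 0"
    "\<And>q. \<lbrakk>q \<in> topspace (Euclidean_space n); \<And>i. i < n \<Longrightarrow> \<bar>q i - p i\<bar> < d\<rbrakk> \<Longrightarrow>
       \<bar>f q - f p - (\<Sum>j<n. partial_deriv j f p * (q j - p j))\<bar> \<le> e * (\<Sum>j<n. \<bar>q j - p j\<bar>)"
proof -
  define T where "T j = {x \<in> S. partial_deriv j f x \<in> ball (partial_deriv j f p) e}" for j
  have T: "openin (Euclidean_space n) (T j)" if "j < n" for j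
  proof -
    have "openin (subtopology (Euclidean_space n) S) (T j)"
      using openin_continuous_map_preimage[of "subtopology (Euclidean_space n) S" euclideanreal
          "partial_deriv j f" "ball (partial_deriv j f p) e"] f that
      unfolding T_def topspace_subtopology_open[OF S] by simp
    with S show ?thesis using openin_trans_full by blast
  qed
  define U where "U = S \<inter> (\<Inter>j\<in>{..<n}. T j)"
  have "openin (Euclidean_space n) U"
  \<comment> \<open>\<open>openin_Inter\<close> wants a nonempty family, so dimension 0 is treated
    apart.\<close>
  proof (cases "n = 0")
    case True
    then show ?thesis using S by (simp add: U_def)
  next
    case False
    then show ?thesis unfolding U_def using T S
      by (intro openin_Int openin_Inter) auto
  qed
  moreover have "p \<in> U" using p e by (auto simp: U_def T_def)
  ultimately obtain d where d: "d > 0"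
    "\<And>q. \<lbrakk>q \<in> topspace (Euclidean_space n); \<And>i. i < n \<Longrightarrow> \<bar>q i - p i\<bar> < d\<rbrakk> \<Longrightarrow> q \<in> U"
    using openin_Euclidean_space_box by blast
  have pE: "p \<in> topspace (Euclidean_space n)" using S p openin_subset by blast
  show thesis
  proof
    fix q assume q: "q \<in> topspace (Euclidean_space n)" "\<And>i. i < n \<Longrightarrow> \<bar>q i - p i\<bar> < d"
    \<comment> \<open>Move from \<open>p\<close> to \<open>q\<close> one coordinate at a time, estimating each step by the mean value theorem.\<close>
    define h where "h l i = (if i < l then q i else p i)" for l i
    have step: "\<bar>f (h (Suc l)) - f (h l) - partial_deriv l f p * (q l - p l)\<bar> \<le> e * \<bar>q l - p l\<bar>"
      if l: "l < n" for l
    proof -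
      \<comment> \<open>With the linear term subtracted, the derivative of \<open>F\<close> is the
        difference of two values of the partial derivative, at most \<open>e\<close> in absolute
        value.\<close>
      define F where "F t = f ((h l)(l := t)) - partial_deriv l f p * t" for t
      have inU: "(h l)(l := t) \<in> U" if "t \<in> closed_segment (p l) (q l)" for t
      proof (rule d(2))
        show "(h l)(l := t) \<in> topspace (Euclidean_space n)"
          using q pE l by (auto simp: h_def topspace_Euclidean_space)
        have "\<bar>t - p l\<bar> \<le> \<bar>q l - p l\<bar>"
          using that by (auto simp: closed_segment_eq_real_ivl split: if_splits)
        then show "\<bar>((h l)(l := t)) i - p i\<bar> < d" if "i < n" for i
          using q(2) l that d(1) by (force simp: h_def)
      qed
      have "norm (F (q l) - F (p l)) \<le> e * norm (q l - p l)"
      proof (rule field_differentiable_bound[of "closed_segment (p l) (q l)"])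
        fix t assume t: "t \<in> closed_segment (p l) (q l)"
        let ?y = "(h l)(l := t)"
        have y: "?y \<in> S" "?y \<in> T l" using inU[OF t] l by (auto simp: U_def)
        have "((\<lambda>s. f (?y(l := s))) has_real_derivative partial_deriv l f ?y) (at (?y l))"
          using Ck_on_has_partial_deriv[OF f y(1) l] .
        then have "(F has_real_derivative partial_deriv l f ?y - partial_deriv l f p) (at t)"
          unfolding F_def by (auto intro!: derivative_eq_intros)
        then show "(F has_real_derivative partial_deriv l f ?y - partial_deriv l f p)
            (at t within closed_segment (p l) (q l))"
          by (rule has_field_derivative_at_within)
        show "norm (partial_deriv l f ?y - partial_deriv l f p) \<le> e"
          using y(2) by (auto simp: T_def dist_real_def)
      qed auto
      moreover have "(h l)(l := q l) = h (Suc l)" "(h l)(l := p l) = h l"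
        by (auto simp: h_def fun_eq_iff less_Suc_eq)
      ultimately show ?thesis by (simp add: F_def algebra_simps)
    qed
    \<comment> \<open>From index \<open>n\<close> on, \<open>h n\<close> has the entries of
      \<open>p\<close>, which are zero like those of \<open>q\<close>.\<close>
    have "h n = q" using q(1) pE by (auto simp: h_def fun_eq_iff topspace_Euclidean_space)
    moreover have "h 0 = p" by (auto simp: h_def)
    ultimately have "f q - f p = (\<Sum>l<n. f (h (Suc l)) - f (h l))"
      using sum_lessThan_telescope[of "\<lambda>l. f (h l)" n] by simp
    then have "\<bar>f q - f p - (\<Sum>j<n. partial_deriv j f p * (q j - p j))\<bar>
        = \<bar>\<Sum>l<n. f (h (Suc l)) - f (h l) - partial_deriv l f p * (q l - p l)\<bar>"
      by (simp add: sum_subtractf)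
    also have "\<dots> \<le> (\<Sum>l<n. e * \<bar>q l - p l\<bar>)"
      using step by (intro order.trans[OF sum_abs] sum_mono) auto
    finally show "\<bar>f q - f p - (\<Sum>j<n. partial_deriv j f p * (q j - p j))\<bar>
        \<le> e * (\<Sum>j<n. \<bar>q j - p j\<bar>)"
      by (simp add: sum_distrib_left)
  qed (rule d(1))
qed

text \<open>The linearization error is small relative to the l^1 distance from \<open>c t\<close> to
  \<open>c a\<close>, and this distance is O(|t - a|) because the components of \<open>c\<close> are
  differentiable at \<open>a\<close>.\<close>

lemma C1_chain_rule:
  assumes S: "openin (Euclidean_space n) S" and f: "Ck_on n (Suc 0) S f"
    and c: "c a \<in> S" "\<forall>\<^sub>F t in at a. c t \<in> topspace (Euclidean_space n)"
    and D: "\<And>j. j < n \<Longrightarrow> ((\<lambda>t. c t j) has_real_derivative D j) (at a)"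
  shows "((\<lambda>t. f (c t)) has_real_derivative (\<Sum>j<n. partial_deriv j f (c a) * D j)) (at a)"
proof -
  define L where "L t = (\<Sum>j<n. partial_deriv j f (c a) * (c t j - c a j))" for t
  define r where "r t = f (c t) - f (c a) - L t" for t
  \<comment> \<open>The summand 1 makes \<open>M\<close> positive and strictly larger than the limit
    of the quotients, so that it eventually bounds them.\<close>
  define M where "M = 1 + (\<Sum>j<n. \<bar>D j\<bar>)"
  have M: "M > 0" unfolding M_def by (simp add: add_pos_nonneg sum_nonneg)
  have L: "(L has_real_derivative (\<Sum>j<n. partial_deriv j f (c a) * D j)) (at a)"
    unfolding L_def by (auto intro!: derivative_eq_intros D sum.cong)
  have quot: "((\<lambda>t. \<Sum>j<n. \<bar>c t j - c a j\<bar> / \<bar>t - a\<bar>) \<longlongrightarrow> (\<Sum>j<n. \<bar>D j\<bar>)) (at a)"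
    using D unfolding has_field_derivative_iff
    by (intro tendsto_sum) (auto dest: tendsto_rabs simp flip: abs_divide)
  then have M_ev: "\<forall>\<^sub>F t in at a. (\<Sum>j<n. \<bar>c t j - c a j\<bar> / \<bar>t - a\<bar>) < M"
    by (rule order_tendstoD) (simp add: M_def)
  \<comment> \<open>As \<open>r a = 0\<close>, this is the difference quotient of \<open>r\<close>:
    the remainder has derivative 0 at \<open>a\<close>.\<close>
  have "((\<lambda>t. r t / (t - a)) \<longlongrightarrow> 0) (at a)"
  proof (rule tendstoI)
    fix e :: real assume "e > 0"
    then have "e / M > 0" using M by simp
    then obtain d where d: "d > 0"
      "\<And>q. \<lbrakk>q \<in> topspace (Euclidean_space n); \<And>i. i < n \<Longrightarrow> \<bar>q i - c a i\<bar> < d\<rbrakk> \<Longrightarrow>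
       \<bar>f q - f (c a) - (\<Sum>j<n. partial_deriv j f (c a) * (q j - c a j))\<bar>
         \<le> e / M * (\<Sum>j<n. \<bar>q j - c a j\<bar>)"
      using C1_linearization[OF S f c(1)] by blast
    have "\<forall>\<^sub>F t in at a. \<bar>c t j - c a j\<bar> < d" if "j < n" for j
    proof -
      have "((\<lambda>t. c t j) \<longlongrightarrow> c a j) (at a)"
        using DERIV_isCont[OF D[OF that]] by (simp add: isCont_def)
      from tendstoD[OF this d(1)] show ?thesis by (simp add: dist_real_def)
    qed
    then have "\<forall>\<^sub>F t in at a. \<forall>j\<in>{..<n}. \<bar>c t j - c a j\<bar> < d"
      by (intro eventually_ball_finite) auto
    moreover have "\<forall>\<^sub>F t in at a. t \<noteq> a" by (simp add: eventually_at_filter)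
    ultimately show "\<forall>\<^sub>F t in at a. dist (r t / (t - a)) 0 < e"
      using c(2) M_ev
    proof eventually_elim
      case (elim t)
      have "\<bar>r t\<bar> \<le> e / M * (\<Sum>j<n. \<bar>c t j - c a j\<bar>)"
        using d(2)[of "c t"] elim by (simp add: r_def L_def)
      then have "\<bar>r t\<bar> / \<bar>t - a\<bar> \<le> e / M * (\<Sum>j<n. \<bar>c t j - c a j\<bar>) / \<bar>t - a\<bar>"
        by (rule divide_right_mono) simp
      also have "\<dots> = e / M * (\<Sum>j<n. \<bar>c t j - c a j\<bar> / \<bar>t - a\<bar>)"
        by (simp only: sum_divide_distrib[symmetric] times_divide_eq_right)
      also have "\<dots> < e / M * M"
        using elim \<open>e / M > 0\<close> by (intro mult_strict_left_mono)
      finally show ?case using M by simp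
    qed
  qed
  then have r: "(r has_real_derivative 0) (at a)"
    by (simp add: has_field_derivative_iff r_def L_def)
  have "((\<lambda>t. r t + L t + f (c a)) has_real_derivative
      0 + (\<Sum>j<n. partial_deriv j f (c a) * D j) + 0) (at a)"
    by (intro derivative_intros r L)
  then show ?thesis by (simp add: r_def)
qed

text \<open>By the chain rule, a partial derivative of the composite is a sum of products. One
  factor is a partial derivative of \<open>g\<close> composed with \<open>f\<close>, covered by the
  induction hypothesis since \<open>g\<close> is arbitrary there; the other is a partial derivative
  of a component of \<open>f\<close>.\<close>

lemma Ck_on_compose:
  assumes S: "openin (Euclidean_space n) S" and T: "openin (Euclidean_space m) T"
    and fT: "f ` S \<subseteq> T"
    and "\<And>j. j < m \<Longrightarrow> Ck_on n k S (\<lambda>x. f x j)" "Ck_on m k T g"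
  shows "Ck_on n k S (\<lambda>x. g (f x))"
  using assms(4,5)
proof (induction k arbitrary: g)
  case (0 g)
  have TE: "T \<subseteq> topspace (Euclidean_space m)" using T openin_subset by blast
  have "continuous_map (subtopology (Euclidean_space n) S) (subtopology (Euclidean_space m) T) f"
    unfolding continuous_map_in_subtopology continuous_map_Euclidean_space_iff_components
    using 0 fT TE by (auto simp: topspace_subtopology_open[OF S])
  from continuous_map_compose[OF this] 0 show ?case by (simp add: o_def)
next
  case (Suc k g)
  have TE: "T \<subseteq> topspace (Euclidean_space m)" using T openin_subset by blast
  have C: "Ck_on m (Suc 0) T g"
    using Suc.prems(2) Ck_on_imp_continuous_map[of m k T] by simp
  have IH: "Ck_on n k S (\<lambda>x. h (f x))" if "Ck_on m k T h" for h
    using Suc.prems(1)[THEN Ck_on_SucD] that by (rule Suc.IH)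
  have d: "((\<lambda>t. g (f (x(i := t)))) has_real_derivative
      (\<Sum>j<m. partial_deriv j g (f x) * partial_deriv i (\<lambda>x. f x j) x)) (at (x i))"
    if "x \<in> S" "i < n" for x i
  proof -
    have "\<forall>\<^sub>F t in nhds (x i). f (x(i := t)) \<in> topspace (Euclidean_space m)"
      by (rule eventually_mono[OF eventually_update_in_open[OF S that]]) (use fT TE in auto)
    then have "\<forall>\<^sub>F t in at (x i). f (x(i := t)) \<in> topspace (Euclidean_space m)"
      by (auto simp: eventually_at_filter elim: eventually_mono)
    moreover have "f (x(i := x i)) \<in> T" using that fT by auto
    ultimately have "((\<lambda>t. g (f (x(i := t)))) has_real_derivative
      (\<Sum>j<m. partial_deriv j g (f (x(i := x i))) * partial_deriv i (\<lambda>x. f x j) x)) (at (x i))"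
      using Suc.prems(1) that
      by (intro C1_chain_rule[OF T C] Ck_on_has_partial_deriv[of n k S])
    then show ?thesis by simp
  qed
  have "Ck_on n k S (partial_deriv i (\<lambda>x. g (f x)))" if "i < n" for i
  proof (rule Ck_on_cong[OF S])
    show "Ck_on n k S (\<lambda>x. \<Sum>j<m. partial_deriv j g (f x) * partial_deriv i (\<lambda>x. f x j) x)"
      using Suc.prems that by (intro Ck_on_sum[OF S] Ck_on_mult[OF S] IH) auto
    show "(\<Sum>j<m. partial_deriv j g (f x) * partial_deriv i (\<lambda>x. f x j) x)
        = partial_deriv i (\<lambda>x. g (f x)) x" if "x \<in> S" for x
      using DERIV_imp_deriv[OF d[OF that \<open>i < n\<close>]] by (simp add: partial_deriv_def)
  qed
  moreover have "(\<lambda>t. g (f (x(i := t)))) differentiable (at (x i))" if "x \<in> S" "i < n" for x i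
    using d[OF that] real_differentiable_def by blast
  moreover have "continuous_map (subtopology (Euclidean_space n) S) euclideanreal (\<lambda>x. g (f x))"
    using IH[OF Ck_on_SucD[OF Suc.prems(2)]] Ck_on_imp_continuous_map by blast
  ultimately show ?case by simp
qed


section \<open>Composition of smooth maps between manifolds\<close>

lemma smooth_on_cong:
  assumes "openin (Euclidean_space n) S" "\<And>x. x \<in> S \<Longrightarrow> f x = g x" "smooth_on n m S f"
  shows "smooth_on n m S g"
  unfolding smooth_on_def
proof (intro conjI allI impI)
  show "g ` S \<subseteq> topspace (Euclidean_space m)"
    using assms(2,3) unfolding smooth_on_def by force
  show "Ck_on n k S (\<lambda>x. g x j)" if "j < m" for j k
  proof (rule Ck_on_cong[OF assms(1)])
    show "Ck_on n k S (\<lambda>x. f x j)" using assms(3) that unfolding smooth_on_def by blast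
  qed (simp add: assms(2))
qed

lemma smooth_on_subset: "smooth_on n m T f \<Longrightarrow> S \<subseteq> T \<Longrightarrow> smooth_on n m S f"
  unfolding smooth_on_def by (auto intro: Ck_on_subset[of n _ T _ S])

lemma smooth_on_local:
  assumes "\<And>x. x \<in> S \<Longrightarrow>
    \<exists>T. openin (Euclidean_space n) T \<and> x \<in> T \<and> T \<subseteq> S \<and> smooth_on n m T f"
  shows "smooth_on n m S f"
  unfolding smooth_on_def
proof (intro conjI allI impI)
  show "f ` S \<subseteq> topspace (Euclidean_space m)"
    using assms unfolding smooth_on_def by blast
  show "Ck_on n k S (\<lambda>x. f x j)" if "j < m" for j k
  proof (rule Ck_on_local)
    fix x assume "x \<in> S"
    then obtain T where "openin (Euclidean_space n) T" "x \<in> T" "T \<subseteq> S" "smooth_on n m T f"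
      using assms by blast
    with that show "\<exists>T. openin (Euclidean_space n) T \<and> x \<in> T \<and> T \<subseteq> S \<and> Ck_on n k T (\<lambda>x. f x j)"
      by (auto simp: smooth_on_def)
  qed
qed

lemma smooth_on_compose:
  assumes "openin (Euclidean_space n) S" "openin (Euclidean_space m) T" "f ` S \<subseteq> T"
    and "smooth_on n m S f" "smooth_on m l T g"
  shows "smooth_on n l S (g \<circ> f)"
  unfolding smooth_on_def
proof (intro conjI allI impI)
  show "(g \<circ> f) ` S \<subseteq> topspace (Euclidean_space l)"
    using assms(3,5) unfolding smooth_on_def by auto
  show "Ck_on n k S (\<lambda>x. (g \<circ> f) x j)" if "j < l" for j k
    using Ck_on_compose[OF assms(1-3), of k "\<lambda>y. g y j"] assms(4,5) that
    by (simp add: smooth_on_def)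
qed

section \<open>Charts and their inverses\<close>

text \<open>It makes the domains of local representatives open, as the congruence and composition
  rules for \<open>smooth_on\<close> require.\<close>

lemma is_chart_openin_image:
  assumes "is_chart T n (U, \<phi>)" "openin T P" "P \<subseteq> U"
  shows "openin (Euclidean_space n) (\<phi> ` P)"
proof -
  have hom: "homeomorphic_map (subtopology T U) (subtopology (Euclidean_space n) (\<phi> ` U)) \<phi>"
    and U: "openin T U" "openin (Euclidean_space n) (\<phi> ` U)"
    using assms(1) by (auto simp: is_chart_def)
  have "openin (subtopology T U) P"
    using assms(2,3) by (simp add: openin_open_subtopology U)
  then have "openin (subtopology (Euclidean_space n) (\<phi> ` U)) (\<phi> ` P)"
    using homeomorphic_imp_open_map[OF hom] by (simp add: open_map_def)
  then show ?thesis using U(2) openin_trans_full by blast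
qed

lemma is_chart_inv_into:
  assumes "is_chart T n (U, \<phi>)" "p \<in> U"
  shows "inv_into U \<phi> (\<phi> p) = p"
proof -
  have "topspace (subtopology T U) = U"
    using assms(1) by (intro topspace_subtopology_open) (simp add: is_chart_def)
  moreover have "inj_on \<phi> (topspace (subtopology T U))"
    using assms(1) unfolding is_chart_def by (auto simp: homeomorphic_eq_everything_map)
  ultimately show ?thesis using assms(2) by simp
qed

lemma smooth_manifold_chart: "smooth_manifold X \<Longrightarrow> c \<in> atlas X \<Longrightarrow> is_chart (mtop X) (mdim X) c"
  by (simp add: smooth_manifold_def)

lemma smooth_manifold_chart_open:
  "smooth_manifold X \<Longrightarrow> (U, \<phi>) \<in> atlas X \<Longrightarrow> openin (mtop X) U"
  using smooth_manifold_chart by (fastforce simp: is_chart_def)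

lemma openin_chart_domain_vimage:
  assumes "continuous_map S T f" "openin S U" "openin T V"
  shows "openin S (U \<inter> f -` V)"
  using openin_continuous_map_preimage_gen[OF assms] by (simp add: vimage_def Collect_conj_eq)

section \<open>Congruence and composition for \<open>smooth_map\<close>\<close>

lemma smooth_map_cong:
  assumes X: "smooth_manifold X" and Y: "smooth_manifold Y"
    and eq: "\<And>x. x \<in> points X \<Longrightarrow> f x = g x" and f: "smooth_map X Y f"
  shows "smooth_map X Y g"
  unfolding smooth_map_def
proof (safe)
  show g: "continuous_map (mtop X) (mtop Y) g"
    using f eq unfolding smooth_map_def by (auto elim: continuous_map_eq)
  fix U \<phi> V \<psi> assume c: "(U, \<phi>) \<in> atlas X" "(V, \<psi>) \<in> atlas Y"
  have U: "openin (mtop X) U" and V: "openin (mtop Y) V"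
    using smooth_manifold_chart_open X Y c by auto
  have UX: "U \<subseteq> points X" using U by (rule openin_subset)
  \<comment> \<open>The full preimages may differ outside \<open>points X\<close>; inside a chart
    domain they agree.\<close>
  have eqv: "U \<inter> f -` V = U \<inter> g -` V" using UX eq by auto
  show "smooth_on (mdim X) (mdim Y) (\<phi> ` (U \<inter> g -` V)) (\<psi> \<circ> g \<circ> inv_into U \<phi>)"
  proof (rule smooth_on_cong)
    show "openin (Euclidean_space (mdim X)) (\<phi> ` (U \<inter> g -` V))"
      using smooth_manifold_chart[OF X c(1)] openin_chart_domain_vimage[OF g U V]
      by (rule is_chart_openin_image) auto
    show "smooth_on (mdim X) (mdim Y) (\<phi> ` (U \<inter> g -` V)) (\<psi> \<circ> f \<circ> inv_into U \<phi>)"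
      using f c unfolding smooth_map_def eqv[symmetric] by blast
    show "(\<psi> \<circ> f \<circ> inv_into U \<phi>) x = (\<psi> \<circ> g \<circ> inv_into U \<phi>) x"
      if "x \<in> \<phi> ` (U \<inter> g -` V)" for x
      using that UX eq is_chart_inv_into[OF smooth_manifold_chart[OF X c(1)]] by auto
  qed
qed

lemma smooth_map_compose:
  assumes X: "smooth_manifold X" and Y: "smooth_manifold Y" and Z: "smooth_manifold Z"
    and f: "smooth_map X Y f" and g: "smooth_map Y Z g"
  shows "smooth_map X Z (g \<circ> f)"
  unfolding smooth_map_def
proof (safe)
  have cf: "continuous_map (mtop X) (mtop Y) f" and cg: "continuous_map (mtop Y) (mtop Z) g"
    using f g by (auto simp: smooth_map_def)
  then show "continuous_map (mtop X) (mtop Z) (g \<circ> f)"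
    by (rule continuous_map_compose)
  fix U \<phi> W \<theta> assume c: "(U, \<phi>) \<in> atlas X" "(W, \<theta>) \<in> atlas Z"
  note chU = smooth_manifold_chart[OF X c(1)]
  have U: "openin (mtop X) U" and W: "openin (mtop Z) W"
    using smooth_manifold_chart_open X Z c by auto
  show "smooth_on (mdim X) (mdim Z) (\<phi> ` (U \<inter> (g \<circ> f) -` W)) (\<theta> \<circ> (g \<circ> f) \<circ> inv_into U \<phi>)"
  proof (rule smooth_on_local)
    fix x assume "x \<in> \<phi> ` (U \<inter> (g \<circ> f) -` W)"
    then obtain p where p: "p \<in> U" "g (f p) \<in> W" "x = \<phi> p" by auto
    have "f p \<in> points Y"
      using cf p(1) openin_subset[OF U] by (auto simp: continuous_map_def)
    then obtain V \<psi> where V\<psi>: "(V, \<psi>) \<in> atlas Y" "f p \<in> V"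
      using Y unfolding smooth_manifold_def by (metis (no_types, lifting) UN_E prod.collapse)
    note chV = smooth_manifold_chart[OF Y V\<psi>(1)]
    \<comment> \<open>\<open>N\<close> and \<open>D\<close> are cut out so that \<open>f\<close>
      sends \<open>D\<close> into \<open>N\<close> and \<open>g\<close> sends \<open>N\<close> into
      \<open>W\<close>. On the image of \<open>D\<close> the local representative of the composite
      then factors through the middle chart \<open>\<psi>\<close>.\<close>
    define N where "N = V \<inter> g -` W"
    define D where "D = U \<inter> f -` N"
    have N: "openin (mtop Y) N"
      unfolding N_def using cg smooth_manifold_chart_open[OF Y V\<psi>(1)] W
      by (rule openin_chart_domain_vimage)
    have D: "openin (mtop X) D"
      unfolding D_def using cf U N by (rule openin_chart_domain_vimage)
    have oD: "openin (Euclidean_space (mdim X)) (\<phi> ` D)"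
      using chU D by (rule is_chart_openin_image) (auto simp: D_def)
    have "smooth_on (mdim X) (mdim Z) (\<phi> ` D)
        ((\<theta> \<circ> g \<circ> inv_into V \<psi>) \<circ> (\<psi> \<circ> f \<circ> inv_into U \<phi>))"
    proof (rule smooth_on_compose[OF oD])
      show "openin (Euclidean_space (mdim Y)) (\<psi> ` N)"
        using chV N by (rule is_chart_openin_image) (auto simp: N_def)
      show "(\<psi> \<circ> f \<circ> inv_into U \<phi>) ` \<phi> ` D \<subseteq> \<psi> ` N"
        using is_chart_inv_into[OF chU] by (auto simp: D_def)
      have "smooth_on (mdim X) (mdim Y) (\<phi> ` (U \<inter> f -` V)) (\<psi> \<circ> f \<circ> inv_into U \<phi>)"
        using f c(1) V\<psi>(1) unfolding smooth_map_def by blast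
      then show "smooth_on (mdim X) (mdim Y) (\<phi> ` D) (\<psi> \<circ> f \<circ> inv_into U \<phi>)"
        by (rule smooth_on_subset) (auto simp: D_def N_def)
      show "smooth_on (mdim Y) (mdim Z) (\<psi> ` N) (\<theta> \<circ> g \<circ> inv_into V \<psi>)"
        using g c(2) V\<psi>(1) unfolding smooth_map_def N_def by blast
    qed
    then have "smooth_on (mdim X) (mdim Z) (\<phi> ` D) (\<theta> \<circ> (g \<circ> f) \<circ> inv_into U \<phi>)"
      by (rule smooth_on_cong[OF oD, rotated])
        (auto simp: D_def N_def is_chart_inv_into[OF chU] is_chart_inv_into[OF chV])
    moreover have "x \<in> \<phi> ` D" "\<phi> ` D \<subseteq> \<phi> ` (U \<inter> (g \<circ> f) -` W)"
      using p V\<psi>(2) by (auto simp: D_def N_def)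
    ultimately show "\<exists>T. openin (Euclidean_space (mdim X)) T \<and> x \<in> T \<and>
        T \<subseteq> \<phi> ` (U \<inter> (g \<circ> f) -` W) \<and>
        smooth_on (mdim X) (mdim Z) T (\<theta> \<circ> (g \<circ> f) \<circ> inv_into U \<phi>)"
      using oD by blast
  qed
qed


section \<open>The groupoid of composable pairs\<close>

text \<open>Multiplying the equation by \<open>ginv \<G> x\<close> from the left isolates
  \<open>y\<close>. Uniqueness of inverses in \<open>S_group\<close> reduces to this.\<close>

lemma (in groupoid) ginv_unique:
  assumes "x \<in> arr \<G>" "y \<in> arr \<G>" "src \<G> x = tgt \<G> y" "cmp \<G> x y = tgt \<G> x"
  shows "y = ginv \<G> x"
proof -
  have "y = cmp \<G> (cmp \<G> (ginv \<G> x) x) y"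
    using assms by (simp add: ginv_cmp tgt_cmp_left)
  also have "\<dots> = cmp \<G> (ginv \<G> x) (cmp \<G> x y)"
    using assms by (intro cmp_assoc) (auto simp: ginv_in src_ginv)
  also have "\<dots> = ginv \<G> x"
    using assms cmp_src[OF ginv_in] by (simp add: src_ginv)
  finally show ?thesis .
qed

lemma pair_groupoid_simps:
  "arr (pair_groupoid \<G>) = {(x, y). x \<in> arr \<G> \<and> y \<in> arr \<G> \<and> src \<G> x = tgt \<G> y}"
  "units (pair_groupoid \<G>) = {(x, src \<G> x) |x. x \<in> arr \<G>}"
  "src (pair_groupoid \<G>) (x, y) = (cmp \<G> x y, src \<G> (cmp \<G> x y))"
  "tgt (pair_groupoid \<G>) (x, y) = (x, src \<G> x)"
  "cmp (pair_groupoid \<G>) (x, y) (z, w) = (x, cmp \<G> y w)"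
  "ginv (pair_groupoid \<G>) (x, y) = (cmp \<G> x y, ginv \<G> y)"
  by (auto simp: pair_groupoid_def composable_pairs_def)

lemma (in groupoid) groupoid_pair_groupoid: "groupoid (pair_groupoid \<G>)"
proof -
  have unit: "src \<G> x \<in> arr \<G>" "tgt \<G> (src \<G> x) = src \<G> x" "src \<G> (src \<G> x) = src \<G> x"
    "tgt \<G> x \<in> arr \<G>" "tgt \<G> (tgt \<G> x) = tgt \<G> x" "src \<G> (tgt \<G> x) = tgt \<G> x"
    if "x \<in> arr \<G>" for x
    using that units_subset src_in tgt_in src_unit tgt_unit by auto
  \<comment> \<open>This makes the source of the inverse pair \<open>(xy, ginv y)\<close> equal to
    the target of \<open>(x, y)\<close>.\<close>
  have cancel: "cmp \<G> (cmp \<G> x y) (ginv \<G> y) = x"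
    if "x \<in> arr \<G>" "y \<in> arr \<G>" "src \<G> x = tgt \<G> y" for x y
    using that cmp_src[OF that(1)] by (simp add: cmp_assoc ginv_in tgt_ginv cmp_ginv)
  note [simp] = unit cancel pair_groupoid_simps cmp_in src_cmp tgt_cmp cmp_src tgt_cmp_left
    ginv_in src_ginv tgt_ginv cmp_ginv ginv_cmp
  \<comment> \<open>The composability premise can rewrite \<open>src \<G> x\<close> to
    \<open>tgt \<G> y\<close>, after which \<open>cmp_src\<close> no longer matches.\<close>
  have right_unit: "cmp \<G> x (tgt \<G> y) = x" if "x \<in> arr \<G>" "src \<G> x = tgt \<G> y" for x y
    using that cmp_src[of x] by simp
  show ?thesis
    by unfold_locales (auto simp: cmp_assoc right_unit)
qed

section \<open>The operations of \<open>S_group\<close> and the inverse of an element\<close>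

lemma carrier_S_group:
  "f \<in> carrier (S_group \<G> X) \<longleftrightarrow> f \<in> extensional (arr \<G>) \<and> smooth_map X X f \<and>
     (\<forall>x\<in>arr \<G>. tgt \<G> (f x) = src \<G> x) \<and> diffeomorphism X X (\<lambda>x. cmp \<G> x (f x))"
  by (auto simp: S_group_def S_monoid_def)

lemma mult_S_group:
  "f \<otimes>\<^bsub>S_group \<G> X\<^esub> g = (\<lambda>x\<in>arr \<G>. cmp \<G> (f x) (g (cmp \<G> x (f x))))"
  by (simp add: S_group_def S_monoid_def)

lemma one_S_group: "\<one>\<^bsub>S_group \<G> X\<^esub> = restrict (src \<G>) (arr \<G>)"
  by (simp add: S_group_def S_monoid_def)

context lie_groupoid
begin

lemma S_group_apply:
  assumes "f \<in> carrier (S_group \<G> X)" "x \<in> arr \<G>"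
  shows "f x \<in> arr \<G>" "tgt \<G> (f x) = src \<G> x"
  using assms unfolding carrier_S_group smooth_map_def arrows
  by (auto simp: continuous_map_def)

text \<open>The inverse is computed by exhibiting a candidate whose right translation is the inverse
  diffeomorphism of that of \<open>f\<close>, which puts it in the carrier.\<close>

lemma m_inv_S_group:
  assumes f: "f \<in> carrier (S_group \<G> X)" and x: "x \<in> arr \<G>"
  shows "(inv\<^bsub>S_group \<G> X\<^esub> f) (cmp \<G> x (f x)) = ginv \<G> (f x)"
proof -
  define R where "R x = cmp \<G> x (f x)" for x
  \<comment> \<open>The equation \<open>f \<star> g = \<alpha>\<close> at \<open>x\<close> forces
    \<open>g (R x) = ginv \<G> (f x)\<close>, and \<open>R x\<close> runs through all
    arrows.\<close>
  define g where "g = (\<lambda>y\<in>arr \<G>. ginv \<G> (f (inv_into (arr \<G>) R y)))"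
  define Q where "Q y = cmp \<G> y (g y)" for y
  note f_in = S_group_apply[OF f]
  have "diffeomorphism X X R" using f by (simp add: carrier_S_group R_def[abs_def])
  then have bij: "bij_betw R (arr \<G>) (arr \<G>)" and R: "smooth_map X X R"
    and R_inv: "smooth_map X X (inv_into (arr \<G>) R)"
    by (auto simp: diffeomorphism_def arrows)
  have R_in: "R x \<in> arr \<G>" if "x \<in> arr \<G>" for x
    using bij that by (rule bij_betw_apply)
  have src_R: "src \<G> (R x) = src \<G> (f x)" if "x \<in> arr \<G>" for x
    using f_in that by (simp add: R_def src_cmp)
  have R_surj: "\<exists>x\<in>arr \<G>. y = R x" if "y \<in> arr \<G>" for y
    using bij that unfolding bij_betw_def by blast
  have inv_R: "inv_into (arr \<G>) R (R x) = x" if "x \<in> arr \<G>" for x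
    using bij that by (rule bij_betw_inv_into_left)
  have g_R: "g (R x) = ginv \<G> (f x)" if "x \<in> arr \<G>" for x
    unfolding g_def using R_in[OF that] by (simp add: inv_R[OF that])
  \<comment> \<open>Here \<open>(x f(x)) f(x)^-1 = x\<close>, so \<open>Q\<close> is the inverse of
    \<open>R\<close> on arrows.\<close>
  have Q_R: "Q (R x) = x" if x: "x \<in> arr \<G>" for x
  proof -
    have "Q (R x) = cmp \<G> x (cmp \<G> (f x) (ginv \<G> (f x)))"
      using x f_in[OF x] unfolding Q_def g_R[OF x] unfolding R_def
      by (intro cmp_assoc) (auto simp: ginv_in tgt_ginv)
    then show ?thesis using x f_in[OF x] by (simp add: cmp_ginv cmp_src)
  qed
  have Q_eq: "inv_into (arr \<G>) R y = Q y" if "y \<in> arr \<G>" for y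
    using R_surj[OF that] inv_R Q_R by auto
  have "bij_betw (inv_into (arr \<G>) R) (arr \<G>) (arr \<G>)"
    using bij by (rule bij_betw_inv_into)
  then have Q_bij: "bij_betw Q (arr \<G>) (arr \<G>)"
    using bij_betw_cong[of "arr \<G>" "inv_into (arr \<G>) R" Q "arr \<G>", OF Q_eq] by simp
  \<comment> \<open>Both directions of smoothness for \<open>Q\<close> come from \<open>R\<close>:
    \<open>Q\<close> agrees on arrows with the inverse of \<open>R\<close>, and the inverse of
    \<open>Q\<close> with \<open>R\<close>.\<close>
  have "inv_into (arr \<G>) Q x = R x" if "x \<in> arr \<G>" for x
    using bij_betw_inv_into_left[OF Q_bij R_in[OF that]] by (simp add: Q_R that)
  then have Q_inv: "smooth_map X X (inv_into (arr \<G>) Q)"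
    using smooth_map_cong[OF manifold_arrows manifold_arrows _ R, of "inv_into (arr \<G>) Q"]
    by (simp add: arrows)
  have "smooth_map X X Q"
    using smooth_map_cong[OF manifold_arrows manifold_arrows _ R_inv, of Q] Q_eq
    by (simp add: arrows)
  with Q_bij Q_inv have Q: "diffeomorphism X X Q"
    by (simp add: diffeomorphism_def arrows)
  have "smooth_map X X (ginv \<G> \<circ> (f \<circ> inv_into (arr \<G>) R))"
    using f R_inv smooth_ginv
    by (intro smooth_map_compose[where Y = X] manifold_arrows) (auto simp: carrier_S_group)
  then have g_smooth: "smooth_map X X g"
    by (rule smooth_map_cong[OF manifold_arrows manifold_arrows, rotated])
      (simp add: g_def arrows)
  have g_tgt: "tgt \<G> (g y) = src \<G> y" if "y \<in> arr \<G>" for y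
    using R_surj[OF that] f_in by (auto simp: g_R src_R tgt_ginv)
  have carrier: "g \<in> carrier (S_group \<G> X)"
    using Q g_smooth g_tgt by (auto simp: carrier_S_group g_def Q_def[abs_def])
  have right: "f \<otimes>\<^bsub>S_group \<G> X\<^esub> g = \<one>\<^bsub>S_group \<G> X\<^esub>"
    unfolding mult_S_group one_S_group
    by (rule restrict_ext) (simp add: R_def[symmetric] g_R f_in cmp_ginv)
  have left: "g \<otimes>\<^bsub>S_group \<G> X\<^esub> f = \<one>\<^bsub>S_group \<G> X\<^esub>"
    unfolding mult_S_group one_S_group
  proof (rule restrict_ext)
    fix y assume "y \<in> arr \<G>"
    then obtain x where x: "x \<in> arr \<G>" "y = R x" using R_surj by blast
    have "cmp \<G> y (g y) = x" using Q_R[OF x(1)] by (simp add: Q_def x(2))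
    then show "cmp \<G> (g y) (f (cmp \<G> y (g y))) = src \<G> y"
      using x by (simp add: g_R src_R ginv_cmp f_in)
  qed
  have unique: "h = g"
    if h: "h \<in> carrier (S_group \<G> X)" and fh: "f \<otimes>\<^bsub>S_group \<G> X\<^esub> h = \<one>\<^bsub>S_group \<G> X\<^esub>" for h
  proof (rule extensionalityI)
    show "h \<in> extensional (arr \<G>)" using h by (simp add: carrier_S_group)
    show "g \<in> extensional (arr \<G>)" by (simp add: g_def)
    fix y assume "y \<in> arr \<G>"
    then obtain x where x: "x \<in> arr \<G>" "y = R x" using R_surj by blast
    \<comment> \<open>Evaluated at \<open>x\<close>, the equation says that \<open>h (R x)\<close>
      is a right inverse of \<open>f x\<close>, as
      \<open>src \<G> x = tgt \<G> (f x)\<close>.\<close>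
    have "cmp \<G> (f x) (h (R x)) = src \<G> x"
      using fun_cong[OF fh, of x] x(1) by (simp add: mult_S_group one_S_group R_def)
    then have "h (R x) = ginv \<G> (f x)"
      using x(1) S_group_apply[OF h R_in[OF x(1)]] by (intro ginv_unique) (simp_all add: f_in src_R)
    then show "h y = g y" using x by (simp add: g_R)
  qed
  have "inv\<^bsub>S_group \<G> X\<^esub> f = g"
    unfolding m_inv_def
  proof (rule the_equality)
    fix h assume "h \<in> carrier (S_group \<G> X) \<and> f \<otimes>\<^bsub>S_group \<G> X\<^esub> h = \<one>\<^bsub>S_group \<G> X\<^esub> \<and>
      h \<otimes>\<^bsub>S_group \<G> X\<^esub> f = \<one>\<^bsub>S_group \<G> X\<^esub>"
    then show "h = g" by (elim conjE) (rule unique)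
  qed (intro conjI carrier right left)
  then show ?thesis using g_R[OF x] by (simp add: R_def)
qed

lemma wide_subgroupoid_graphs:
  assumes A: "subgroup A (S_group \<G> X)"
  shows "wide_subgroupoid (\<Union>f\<in>A. graph \<G> f) (pair_groupoid \<G>)"
proof -
  let ?\<Gamma> = "\<Union>f\<in>A. graph \<G> f"
  interpret pair: groupoid "pair_groupoid \<G>" by (rule groupoid_pair_groupoid)
  have mem: "(x, y) \<in> ?\<Gamma> \<longleftrightarrow> x \<in> arr \<G> \<and> (\<exists>f\<in>A. y = f x)" for x y
    by (auto simp: graph_def)
  note f_in = S_group_apply[OF subsetD[OF subgroup.subset[OF A]]]
  \<comment> \<open>These points form the graph of the neutral element. Sources and targets in
    \<open>pair_groupoid\<close> have this shape too, so closure under both follows as well as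
    wideness.\<close>
  have unit: "(x, src \<G> x) \<in> ?\<Gamma>" if "x \<in> arr \<G>" for x
    unfolding mem using that subgroup.one_closed[OF A] unfolding one_S_group
    by (intro conjI bexI[of _ "restrict (src \<G>) (arr \<G>)"]) simp_all
  show ?thesis
  proof
    show "?\<Gamma> \<subseteq> arr (pair_groupoid \<G>)"
      using f_in by (auto simp: graph_def pair_groupoid_simps)
    show "units (pair_groupoid \<G>) \<subseteq> ?\<Gamma>"
      using unit by (auto simp: pair_groupoid_simps)
  next
    fix p assume "p \<in> ?\<Gamma>"
    then obtain f x where f: "f \<in> A" and x: "x \<in> arr \<G>" and p: "p = (x, f x)"
      by (auto simp: graph_def)
    have R_in: "cmp \<G> x (f x) \<in> arr \<G>" using f_in[OF f x] x by (simp add: cmp_in)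
    then show "src (pair_groupoid \<G>) p \<in> ?\<Gamma>"
      unfolding p pair_groupoid_simps by (rule unit)
    show "tgt (pair_groupoid \<G>) p \<in> ?\<Gamma>"
      unfolding p pair_groupoid_simps using x by (rule unit)
    have "ginv \<G> (f x) = (inv\<^bsub>S_group \<G> X\<^esub> f) (cmp \<G> x (f x))"
      using m_inv_S_group[OF _ x] subgroup.subset[OF A] f by auto
    then show "ginv (pair_groupoid \<G>) p \<in> ?\<Gamma>"
      unfolding p pair_groupoid_simps mem using R_in subgroup.m_inv_closed[OF A f] by blast
    fix q assume "q \<in> ?\<Gamma>" and comp: "src (pair_groupoid \<G>) p = tgt (pair_groupoid \<G>) q"
    \<comment> \<open>Composability fixes the first entry of \<open>q\<close>, which is exactly the
      argument of \<open>g\<close> in the product \<open>f \<star> g\<close> at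
      \<open>x\<close>.\<close>
    then obtain g where g: "g \<in> A" and q: "q = (cmp \<G> x (f x), g (cmp \<G> x (f x)))"
      by (auto simp: graph_def p pair_groupoid_simps)
    have "(f \<otimes>\<^bsub>S_group \<G> X\<^esub> g) x = cmp \<G> (f x) (g (cmp \<G> x (f x)))"
      using x by (simp add: mult_S_group)
    with subgroup.m_closed[OF A f g] show "cmp (pair_groupoid \<G>) p q \<in> ?\<Gamma>"
      unfolding p q pair_groupoid_simps mem using x
      by (intro conjI bexI[of _ "f \<otimes>\<^bsub>S_group \<G> X\<^esub> g"]) simp_all
  qed
qed

end

theorem lemma5p5:
  fixes \<G> :: "'g groupoid" and X :: "'g manifold" and k :: nat and A :: "('g \<Rightarrow> 'g) set"
  assumes "lie_groupoid \<G> X k"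
    and "subgroup A (S_group \<G> X)"
  shows "wide_subgroupoid (\<Union>f\<in>A. graph \<G> f) (pair_groupoid \<G>)"
  using assms by (rule lie_groupoid.wide_subgroupoid_graphs)

end
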